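(* Let $f:\mathbb{R}^d\to\mathbb{R}$ be $\mu$-strongly-convex and $L$-smooth, with minimizer $x^*$. If $n,m,q\ge 0$ then, for any value of the strong-convexity modulus $\mu\ge 0$, the point $(x^*,0)\in\mathbb{R}^{2d}$ is globally asymptotically stable for the ODE system $$\dot X=-m\nabla f(X)-nV,\qquad \dot V=\nabla f(X)-qV,$$ as its solutions satisfy $$\mathcal{E}(X(t),V(t))\le e^{-\gamma_1 t}\cdot\mathcal{E}(X(0),V(0)),$$ where $$\gamma_1 := \min\left(\frac{\mu(n+qm)}{2q},\ \frac{q}{2}\right)$$ and $$\mathcal{E}(X,V)=(qm+n)\big(f(X)-f(x^* )\big)+\tfrac14\|q(X-x^* )-nV\|^2+\tfrac{n(qm+n)}{4}\|V\|^2 .$$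
   Context: $\|\cdot\|$ is the Euclidean norm on $\mathbb{R}^d$. $f$ is $L$-smooth if it is differentiable and $\|\nabla f(x)-\nabla f(y)\|\le L\|x-y\|$ for all $x,y$. $f$ is $\mu$-strongly-convex if $f(y)\ge f(x)+\langle\nabla f(x),y-x\rangle+\frac{\mu}{2}\|y-x\|^2$ for all $x,y$ (for twice continuously differentiable $f$, equivalently $\nabla^2 f(x)-\mu I$ is positive semidefinite for all $x$). $x^*=\operatorname{argmin}_{x\in\mathbb{R}^d}f(x)$. The ODE system has real parameters $m,n,q$; $(X(t),V(t))$, $t\ge 0$, denotes its solution from the initial condition $(X(0),V(0))\in\mathbb{R}^{2d}$.
   Formalization: Global asymptotic stability is stated only when x* is the unique minimizer and at least two of n, m, q are positive; otherwise it is false (e.g. n=m=0 keeps X constant). The decay estimate is stated for all n, m, q ≥ 0, with γ₁ read as 0 when q=0. *)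

theory Defs
  imports "HOL-Analysis.Analysis"
begin

definition gradient :: "('a::euclidean_space \<Rightarrow> real) \<Rightarrow> 'a \<Rightarrow> 'a"
  where "gradient f x = (THE D. GDERIV f x :> D)"

lemma gradient_eq:
  assumes "GDERIV f x :> D"
  shows "gradient f x = D"
proof -
  have "D' = D" if "GDERIV f x :> D'" for D'
  proof -
    have "(\<lambda>h. inner h D') = (\<lambda>h. inner h D)"
      using assms that unfolding gderiv_def by (rule has_derivative_unique[rotated])
    then show ?thesis
      by (metis inner_commute vector_eq_ldot)
  qed
  then show ?thesis
    using assms unfolding gradient_def by blast
qed

lemma gderiv_gradient:
  fixes f :: "'a::euclidean_space \<Rightarrow> real"
  assumes "f differentiable (at x)"
  shows "GDERIV f x :> gradient f x"
proof -
  obtain f' where f': "(f has_derivative f') (at x)"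
    using assms by (auto simp: differentiable_def)
  then have lin: "linear f'"
    by (rule has_derivative_linear)
  define D where "D = (\<Sum>b\<in>Basis. f' b *\<^sub>R b)"
  have "f' = (\<lambda>h. inner h D)"
  proof
    fix h
    have "f' h = f' (\<Sum>b\<in>Basis. inner h b *\<^sub>R b)"
      by (simp add: euclidean_representation)
    also have "\<dots> = (\<Sum>b\<in>Basis. inner h b * f' b)"
      by (simp add: linear_sum[OF lin] linear_scale[OF lin])
    also have "\<dots> = inner h D"
      by (simp add: D_def inner_sum_right mult.commute)
    finally show "f' h = inner h D" .
  qed
  with f' have "GDERIV f x :> D"
    by (simp add: gderiv_def)
  then show ?thesis
    using gradient_eq by metis
qed

definition smooth_fun :: "real \<Rightarrow> ('a::euclidean_space \<Rightarrow> real) \<Rightarrow> bool"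
  where "smooth_fun L f \<longleftrightarrow>
    (\<forall>x. f differentiable (at x)) \<and>
    (\<forall>x y. norm (gradient f x - gradient f y) \<le> L * norm (x - y))"

text \<open>Only meaningful for differentiable \<open>f\<close>; the modulus 0 gives plain convexity.\<close>

definition strongly_convex :: "real \<Rightarrow> ('a::euclidean_space \<Rightarrow> real) \<Rightarrow> bool"
  where "strongly_convex \<mu> f \<longleftrightarrow>
    (\<forall>x y. f y \<ge> f x + inner (gradient f x) (y - x) + \<mu> / 2 * (norm (y - x))\<^sup>2)"

text \<open>Solutions of the autonomous equation \<open>z' = F z\<close> on \<open>[0, \<infinity>)\<close>, with the one-sided
  derivative at time 0.\<close>

definition ode_solution :: "('b::real_normed_vector \<Rightarrow> 'b) \<Rightarrow> (real \<Rightarrow> 'b) \<Rightarrow> bool"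
  where "ode_solution F z \<longleftrightarrow>
    (\<forall>t\<ge>0. (z has_vector_derivative F (z t)) (at t within {0..}))"

text \<open>The next definitions quantify over solutions defined for all \<open>t \<ge> 0\<close>. They are the usual
  notions for a globally Lipschitz \<open>F\<close>, for which every initial condition has exactly one
  such solution.\<close>

definition lyapunov_stable :: "('b::real_normed_vector \<Rightarrow> 'b) \<Rightarrow> 'b \<Rightarrow> bool"
  where "lyapunov_stable F p \<longleftrightarrow>
    (\<forall>\<epsilon>>0. \<exists>\<delta>>0. \<forall>z. ode_solution F z \<longrightarrow> dist (z 0) p < \<delta> \<longrightarrow>
      (\<forall>t\<ge>0. dist (z t) p < \<epsilon>))"

definition globally_attractive :: "('b::real_normed_vector \<Rightarrow> 'b) \<Rightarrow> 'b \<Rightarrow> bool"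
  where "globally_attractive F p \<longleftrightarrow> (\<forall>z. ode_solution F z \<longrightarrow> (z \<longlongrightarrow> p) at_top)"

definition globally_asymptotically_stable :: "('b::real_normed_vector \<Rightarrow> 'b) \<Rightarrow> 'b \<Rightarrow> bool"
  where "globally_asymptotically_stable F p \<longleftrightarrow>
    F p = 0 \<and> lyapunov_stable F p \<and> globally_attractive F p"

definition momentum_field ::
    "('a::euclidean_space \<Rightarrow> real) \<Rightarrow> real \<Rightarrow> real \<Rightarrow> real \<Rightarrow> 'a \<times> 'a \<Rightarrow> 'a \<times> 'a"
  where "momentum_field f m n q =
    (\<lambda>(x, v). (- m *\<^sub>R gradient f x - n *\<^sub>R v, gradient f x - q *\<^sub>R v))"

definition energy ::
    "('a::euclidean_space \<Rightarrow> real) \<Rightarrow> 'a \<Rightarrow> real \<Rightarrow> real \<Rightarrow> real \<Rightarrow> 'a \<Rightarrow> 'a \<Rightarrow> real"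
  where "energy f xs m n q x v =
    (q * m + n) * (f x - f xs)
    + 1 / 4 * (norm (q *\<^sub>R (x - xs) - n *\<^sub>R v))\<^sup>2
    + n * (q * m + n) / 4 * (norm v)\<^sup>2"

text \<open>For \<open>q = 0\<close> and \<open>\<mu>, n > 0\<close> the first argument of the minimum is informally \<open>+\<infinity>\<close>,
  here it is 0; since the second argument is 0, the rate is 0 under either convention.\<close>

definition rate1 :: "real \<Rightarrow> real \<Rightarrow> real \<Rightarrow> real \<Rightarrow> real"
  where "rate1 \<mu> m n q = min (\<mu> * (n + q * m) / (2 * q)) (q / 2)"

end

theory Submission imports Defs begin

text \<open>
  Write \<open>g = \<nabla>f(X)\<close>, \<open>D = X - x*\<close> and \<open>c = qm + n\<close>. Along a solution \<open>(q D - n V)' = - c g\<close>, so all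
  terms \<open>\<langle>g, V\<rangle>\<close> cancel in
  \<open>E' = - c m |g|\<^sup>2 - (c q / 2) \<langle>g, D\<rangle> - (n c q / 2) |V|\<^sup>2\<close>; strong convexity bounds \<open>\<langle>g, D\<rangle>\<close> from
  below and gives \<open>E' \<le> - \<gamma>\<^sub>1 E\<close>.

  Since \<open>E\<close> does not control \<open>V\<close> when \<open>n = 0\<close>, stability is read off from \<open>F = E + c m q |V|\<^sup>2\<close>, where
  the spare term \<open>- c m |g|\<^sup>2\<close> absorbs the cross term; as \<open>\<mu> = 0\<close> is allowed, coercivity of \<open>f\<close> comes from
  convexity and uniqueness of the minimizer. For \<open>q > 0\<close> the derivative of \<open>F\<close> is negative definite.
  For \<open>q = 0\<close> only \<open>g\<close> is damped, and adding a small multiple of \<open>|V|\<^sup>2 \<langle>D, V\<rangle>\<close> produces the missing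
  dissipation \<open>- |V|\<^sup>4\<close> on the bounded region where the solution lives.
\<close>

section \<open>Functions of one real variable\<close>

lemma has_real_derivative_inner:
  assumes "(A has_vector_derivative A') (at t within S)"
    and "(B has_vector_derivative B') (at t within S)"
  shows "((\<lambda>t. inner (A t) (B t)) has_real_derivative (inner (A t) B' + inner A' (B t))) (at t within S)"
  using bounded_bilinear.has_vector_derivative[OF bounded_bilinear_inner assms]
  by (simp add: has_real_derivative_iff_has_vector_derivative)

lemma has_real_derivative_norm_sq:
  assumes "(A has_vector_derivative A') (at t within S)"
  shows "((\<lambda>t. (norm (A t))\<^sup>2) has_real_derivative 2 * inner (A t) A') (at t within S)"
  using has_real_derivative_inner[OF assms assms]
  by (simp add: power2_norm_eq_inner inner_commute)

lemma has_real_derivative_gradient: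
  fixes f :: "'a::euclidean_space \<Rightarrow> real"
  assumes "f differentiable (at (X t))" and "(X has_vector_derivative X') (at t within S)"
  shows "((\<lambda>t. f (X t)) has_real_derivative inner (gradient f (X t)) X') (at t within S)"
proof -
  have "(f has_derivative (\<lambda>h. inner h (gradient f (X t)))) (at (X t))"
    using gderiv_gradient[OF assms(1)] by (simp add: gderiv_def)
  from has_derivative_compose[OF assms(2)[unfolded has_vector_derivative_def] this]
  show ?thesis
    unfolding has_field_derivative_def
    by (rule has_derivative_eq_rhs) (simp add: fun_eq_iff inner_commute)
qed

text \<open>At time 0 the derivative is only one-sided, so the mean value argument needs plain
  continuity on \<open>{s..t}\<close> and uses derivatives only at interior points, where
  \<open>at x within {0..}\<close> is \<open>at x\<close>.\<close>

lemma nonincreasing_of_derivative: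
  fixes \<phi> :: "real \<Rightarrow> real"
  assumes der: "\<And>t. t \<ge> 0 \<Longrightarrow> (\<phi> has_real_derivative \<phi>' t) (at t within {0..})"
    and nonpos: "\<And>t. t \<ge> 0 \<Longrightarrow> \<phi>' t \<le> 0"
    and "0 \<le> s" "s \<le> t"
  shows "\<phi> t \<le> \<phi> s"
proof (cases "s < t")
  case True
  have "continuous_on {0..} \<phi>"
    using DERIV_continuous[OF der] by (simp add: continuous_on_eq_continuous_within)
  then have "continuous_on {s..t} \<phi>"
    by (rule continuous_on_subset) (use \<open>0 \<le> s\<close> in auto)
  moreover have "\<exists>y. (\<phi> has_real_derivative y) (at x) \<and> y \<le> 0" if "s < x" "x < t" for x
  proof -
    have "at x within {0..} = at x"
      by (rule at_within_interior) (use that \<open>0 \<le> s\<close> in auto)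
    with der[of x] nonpos[of x] that \<open>0 \<le> s\<close> show ?thesis by auto
  qed
  ultimately show ?thesis
    by (intro DERIV_nonpos_imp_decreasing_open[OF \<open>s \<le> t\<close>])
qed (use \<open>s \<le> t\<close> in auto)

text \<open>If \<open>w\<close> stayed above \<open>\<kappa>\<close>, then
  \<open>\<phi> t + \<kappa> * t\<close> would be nonincreasing and \<open>\<phi>\<close> would
  eventually drop below \<open>b\<close>. A single time of small dissipation is obtained, not a
  limit; this suffices for attractivity because the Lyapunov function is monotone.\<close>

lemma dissipation_gets_small:
  fixes \<phi> w :: "real \<Rightarrow> real"
  assumes der: "\<And>t. t \<ge> 0 \<Longrightarrow> (\<phi> has_real_derivative \<phi>' t) (at t within {0..})"
    and le: "\<And>t. t \<ge> 0 \<Longrightarrow> \<phi>' t \<le> - w t"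
    and below: "\<And>t. t \<ge> 0 \<Longrightarrow> b \<le> \<phi> t"
    and "\<kappa> > 0"
  obtains t where "t \<ge> 0" "w t < \<kappa>"
proof (rule ccontr)
  assume "\<not> thesis"
  with that have ge: "\<kappa> \<le> w t" if "t \<ge> 0" for t
    using \<open>t \<ge> 0\<close> by force
  \<comment> \<open>By time \<open>T\<close> the forced decrease \<open>\<kappa> * T\<close> exceeds
    the available amount \<open>\<phi> 0 - b\<close> by 1.\<close>
  define T where "T = (\<phi> 0 - b + 1) / \<kappa>"
  have "T \<ge> 0"
    using below[of 0] \<open>\<kappa> > 0\<close> by (simp add: T_def)
  have "\<phi> T + \<kappa> * T \<le> \<phi> 0 + \<kappa> * 0"
  proof (rule nonincreasing_of_derivative[where \<phi>' = "\<lambda>t. \<phi>' t + \<kappa>" and \<phi> = "\<lambda>t. \<phi> t + \<kappa> * t"])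
    show "((\<lambda>t. \<phi> t + \<kappa> * t) has_real_derivative \<phi>' t + \<kappa>) (at t within {0..})" if "t \<ge> 0" for t
      using der[OF that] by (auto intro!: derivative_eq_intros)
    show "\<phi>' t + \<kappa> \<le> 0" if "t \<ge> 0" for t
      using le[OF that] ge[OF that] by simp
  qed (use \<open>T \<ge> 0\<close> in auto)
  moreover have "\<kappa> * T = \<phi> 0 - b + 1"
    using \<open>\<kappa> > 0\<close> by (simp add: T_def)
  ultimately show False
    using below[OF \<open>T \<ge> 0\<close>] by simp
qed

section \<open>The energy along a solution\<close>

lemma minimizer_gradient_zero:
  fixes f :: "'a::euclidean_space \<Rightarrow> real"
  assumes "f differentiable (at x)" and "\<And>y. f x \<le> f y"
  shows "gradient f x = 0"
proof -
  have "(f has_derivative (\<lambda>h. inner h (gradient f x))) (at x)"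
    using gderiv_gradient[OF assms(1)] by (simp add: gderiv_def)
  then have "(\<lambda>h. inner h (gradient f x)) = (\<lambda>h. 0)"
    by (rule differential_zero_maxmin[where S = UNIV, rotated 2]) (use assms(2) in auto)
  then show ?thesis
    by (metis inner_eq_zero_iff)
qed

text \<open>Only plain convexity is recorded here, so that \<mu> = 0 is covered; the modulus enters
  solely through the decay estimate for the energy.\<close>

locale convex_momentum =
  fixes f :: "'a::euclidean_space \<Rightarrow> real" and xs :: 'a and m n q :: real
  assumes differentiable: "f differentiable (at x)"
    and gradient_le: "f x + inner (gradient f x) (y - x) \<le> f y"
    and minimal: "f xs \<le> f y"
    and m: "m \<ge> 0" and n: "n \<ge> 0" and q: "q \<ge> 0"
begin

abbreviation c where "c \<equiv> q * m + n"

definition lyap where "lyap x v = energy f xs m n q x v + c * m * q * (norm v)\<^sup>2"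

definition momentum_solution where
  "momentum_solution X V \<longleftrightarrow> ode_solution (momentum_field f m n q) (\<lambda>t. (X t, V t))"

lemma c_nonneg: "c \<ge> 0"
  using m n q by simp

lemma gap_le_inner: "f x - f xs \<le> inner (gradient f x) (x - xs)"
  using gradient_le[of x xs] by (simp add: inner_diff_right)

lemma inner_gradient_nonneg: "0 \<le> inner (gradient f x) (x - xs)"
  using gap_le_inner[of x] minimal[of x] by simp

lemma solution_derivatives:
  assumes "momentum_solution X V" "t \<ge> 0"
  shows "(X has_vector_derivative (- m *\<^sub>R gradient f (X t) - n *\<^sub>R V t)) (at t within {0..})"
    and "(V has_vector_derivative (gradient f (X t) - q *\<^sub>R V t)) (at t within {0..})"
proof -
  have "((\<lambda>t. (X t, V t)) has_vector_derivative
      (- m *\<^sub>R gradient f (X t) - n *\<^sub>R V t, gradient f (X t) - q *\<^sub>R V t)) (at t within {0..})"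
    using assms by (simp add: momentum_solution_def ode_solution_def momentum_field_def)
  note d = this[unfolded has_vector_derivative_def]
  show "(X has_vector_derivative (- m *\<^sub>R gradient f (X t) - n *\<^sub>R V t)) (at t within {0..})"
    using has_derivative_fst[OF d] by (simp add: has_vector_derivative_def)
  show "(V has_vector_derivative (gradient f (X t) - q *\<^sub>R V t)) (at t within {0..})"
    using has_derivative_snd[OF d] by (simp add: has_vector_derivative_def)
qed

lemma energy_derivative:
  assumes "momentum_solution X V" "t \<ge> 0"
  shows "((\<lambda>t. energy f xs m n q (X t) (V t)) has_real_derivative
    (- c * m * (norm (gradient f (X t)))\<^sup>2 - c * q / 2 * inner (gradient f (X t)) (X t - xs)
     - n * c * q / 2 * (norm (V t))\<^sup>2)) (at t within {0..})"
proof -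
  note dX = solution_derivatives(1)[OF assms] and dV = solution_derivatives(2)[OF assms]
  let ?g = "gradient f (X t)"
  have dW: "((\<lambda>t. q *\<^sub>R (X t - xs) - n *\<^sub>R V t) has_vector_derivative (- c *\<^sub>R ?g)) (at t within {0..})"
    using dX dV by (auto intro!: derivative_eq_intros simp: algebra_simps)
  have "((\<lambda>t. energy f xs m n q (X t) (V t)) has_real_derivative
     (c * inner ?g (- m *\<^sub>R ?g - n *\<^sub>R V t)
      + 1 / 4 * (2 * inner (q *\<^sub>R (X t - xs) - n *\<^sub>R V t) (- c *\<^sub>R ?g))
      + n * c / 4 * (2 * inner (V t) (?g - q *\<^sub>R V t)))) (at t within {0..})"
    unfolding energy_def
    by (rule derivative_eq_intros refl has_real_derivative_gradient[OF differentiable dX]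
        has_real_derivative_norm_sq[OF dW] has_real_derivative_norm_sq[OF dV] | simp)+
  \<comment> \<open>The terms in \<open>inner g v\<close> carry the coefficients
    \<open>- n * k\<close> from the gap and \<open>n * k / 2\<close> from each squared norm, so they
    cancel. The atom \<open>k\<close> stands for \<open>c\<close>, which keeps
    \<open>q * m + n\<close> from being expanded.\<close>
  moreover have "k * inner g (- m *\<^sub>R g - n *\<^sub>R v)
      + 1 / 4 * (2 * inner (q *\<^sub>R d - n *\<^sub>R v) (- k *\<^sub>R g))
      + n * k / 4 * (2 * inner v (g - q *\<^sub>R v))
    = - k * m * (norm g)\<^sup>2 - k * q / 2 * inner g d - n * k * q / 2 * (norm v)\<^sup>2"
    for k and g d v :: 'a
    by (simp add: power2_norm_eq_inner inner_diff_left inner_diff_right inner_commute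
        field_simps)
  ultimately show ?thesis by (simp only:)
qed

text \<open>The two bounds on the rate serve different terms. \<open>q / 2\<close> handles the gap
  and the \<open>norm v\<close> terms; the bound involving \<mu> makes the
  \<open>norm (x - xs)\<close> term fit exactly into the surplus that strong convexity adds to
  \<open>inner (gradient f x) (x - xs)\<close>.\<close>

lemma energy_rate:
  assumes sc: "strongly_convex \<mu> f" and "\<mu> \<ge> 0"
  shows "rate1 \<mu> m n q * energy f xs m n q x v
    \<le> c * m * (norm (gradient f x))\<^sup>2 + c * q / 2 * inner (gradient f x) (x - xs)
      + n * c * q / 2 * (norm v)\<^sup>2" (is "?r * _ \<le> _")
proof -
  have r: "0 \<le> ?r" "?r \<le> q / 2"
    using \<open>\<mu> \<ge> 0\<close> m n q by (auto simp: rate1_def)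
  \<comment> \<open>At q = 0 both sides vanish, so the division by \<open>2 * q\<close> in
    \<open>rate1\<close> does no harm.\<close>
  have rq: "?r * q\<^sup>2 \<le> \<mu> * c * q / 2"
  proof (cases "q = 0")
    case False
    then have "?r * q\<^sup>2 \<le> \<mu> * (n + q * m) / (2 * q) * q\<^sup>2"
      by (intro mult_right_mono) (auto simp: rate1_def)
    also have "\<dots> = \<mu> * c * q / 2"
      using False by (simp add: field_simps power2_eq_square)
    finally show ?thesis .
  qed simp
  have "f xs \<ge> f x + inner (gradient f x) (xs - x) + \<mu> / 2 * (norm (xs - x))\<^sup>2"
    using sc by (simp add: strongly_convex_def)
  then have D: "f x - f xs + \<mu> / 2 * (norm (x - xs))\<^sup>2 \<le> inner (gradient f x) (x - xs)"
    by (simp add: inner_diff_right norm_minus_commute)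
  \<comment> \<open>Parallelogram law; dropping the square of the sum separates position and
    velocity in the mixed term of the energy.\<close>
  have "(norm (a - b))\<^sup>2 + (norm (a + b))\<^sup>2 = 2 * (norm a)\<^sup>2 + 2 * (norm b)\<^sup>2" for a b :: 'a
    by (simp add: power2_norm_eq_inner inner_diff_left inner_diff_right inner_add_left
        inner_add_right inner_commute)
  from this[of "q *\<^sub>R (x - xs)" "n *\<^sub>R v"] have W: "(norm (q *\<^sub>R (x - xs) - n *\<^sub>R v))\<^sup>2
      \<le> 2 * q\<^sup>2 * (norm (x - xs))\<^sup>2 + 2 * n\<^sup>2 * (norm v)\<^sup>2"
    using zero_le_power2[of "norm (q *\<^sub>R (x - xs) + n *\<^sub>R v)"]
    by (simp only: norm_scaleR power_mult_distrib power2_abs mult.assoc)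
  have 1: "?r * (c * (f x - f xs)) \<le> q / 2 * (c * (f x - f xs))"
    using r c_nonneg minimal[of x] by (intro mult_right_mono) auto
  have 2: "?r * q\<^sup>2 * (norm (x - xs))\<^sup>2 \<le> \<mu> * c * q / 2 * (norm (x - xs))\<^sup>2"
    using rq by (intro mult_right_mono) auto
  have "n\<^sup>2 \<le> n * c"
    using m n q by (simp add: power2_eq_square algebra_simps)
  then have "?r * (n\<^sup>2 / 2 + n * c / 4) \<le> q / 2 * (n * c / 2 + n * c / 4)"
    using r q n c_nonneg by (intro mult_mono) auto
  also have "\<dots> = 3 / 4 * (n * c * q / 2)"
    by (simp add: algebra_simps)
  also have "\<dots> \<le> n * c * q / 2"
    using mult_nonneg_nonneg[OF mult_nonneg_nonneg[OF n c_nonneg] q] by linarith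
  finally have 3: "?r * (n\<^sup>2 / 2 + n * c / 4) * (norm v)\<^sup>2 \<le> n * c * q / 2 * (norm v)\<^sup>2"
    by (intro mult_right_mono) auto
  have "?r * energy f xs m n q x v
    \<le> ?r * (c * (f x - f xs)
        + 1 / 4 * (2 * q\<^sup>2 * (norm (x - xs))\<^sup>2 + 2 * n\<^sup>2 * (norm v)\<^sup>2) + n * c / 4 * (norm v)\<^sup>2)"
    unfolding energy_def using r W by (intro mult_left_mono) auto
  also have "\<dots> = ?r * (c * (f x - f xs)) + ?r * q\<^sup>2 * (norm (x - xs))\<^sup>2 / 2
        + ?r * (n\<^sup>2 / 2 + n * c / 4) * (norm v)\<^sup>2"
    by (simp add: algebra_simps)
  also have "\<dots> \<le> q / 2 * (c * (f x - f xs)) + \<mu> * c * q / 2 * (norm (x - xs))\<^sup>2 / 2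
      + n * c * q / 2 * (norm v)\<^sup>2"
    using 1 2 3 by linarith
  also have "\<dots> = c * q / 2 * (f x - f xs + \<mu> / 2 * (norm (x - xs))\<^sup>2) + n * c * q / 2 * (norm v)\<^sup>2"
    by (simp add: field_simps)
  also have "\<dots> \<le> c * q / 2 * inner (gradient f x) (x - xs) + n * c * q / 2 * (norm v)\<^sup>2"
    using D c_nonneg q by (intro add_right_mono mult_left_mono) auto
  also have "\<dots> \<le> c * m * (norm (gradient f x))\<^sup>2 + c * q / 2 * inner (gradient f x) (x - xs)
      + n * c * q / 2 * (norm v)\<^sup>2"
    using m c_nonneg by simp
  finally show ?thesis .
qed

text \<open>Integrating factor: \<open>energy_rate\<close> says exactly that
  \<open>exp (?r * t) * ?E t\<close> has a nonpositive derivative.\<close>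

lemma energy_decay:
  assumes "strongly_convex \<mu> f" and "\<mu> \<ge> 0" and sol: "momentum_solution X V" and "t \<ge> 0"
  shows "energy f xs m n q (X t) (V t)
    \<le> exp (- rate1 \<mu> m n q * t) * energy f xs m n q (X 0) (V 0)" (is "?E t \<le> exp (- ?r * t) * _")
proof -
  let ?E' = "\<lambda>t. - c * m * (norm (gradient f (X t)))\<^sup>2
     - c * q / 2 * inner (gradient f (X t)) (X t - xs) - n * c * q / 2 * (norm (V t))\<^sup>2"
  have "exp (?r * t) * ?E t \<le> exp (?r * 0) * ?E 0"
  proof (rule nonincreasing_of_derivative[where \<phi> = "\<lambda>t. exp (?r * t) * ?E t"
        and \<phi>' = "\<lambda>t. exp (?r * t) * (?r * ?E t + ?E' t)"])
    fix t :: real assume "t \<ge> 0"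
    show "((\<lambda>t. exp (?r * t) * ?E t) has_real_derivative exp (?r * t) * (?r * ?E t + ?E' t))
        (at t within {0..})"
      by (rule derivative_eq_intros energy_derivative[OF sol \<open>t \<ge> 0\<close>] refl
          | simp add: algebra_simps)+
    show "exp (?r * t) * (?r * ?E t + ?E' t) \<le> 0"
    proof (intro mult_nonneg_nonpos)
      show "?r * ?E t + ?E' t \<le> 0"
        using energy_rate[OF assms(1,2), of "X t" "V t"] by linarith
    qed simp
  qed (use \<open>t \<ge> 0\<close> in auto)
  then show ?thesis
    by (simp add: exp_minus field_simps)
qed

section \<open>A Lyapunov function controlling both components\<close>

definition lyap_deriv where
  "lyap_deriv x v = - c * m * (norm (gradient f x))\<^sup>2 - c * q / 2 * inner (gradient f x) (x - xs)
    - n * c * q / 2 * (norm v)\<^sup>2 + c * m * q * (2 * inner v (gradient f x - q *\<^sub>R v))"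

lemma lyap_derivative:
  assumes "momentum_solution X V" "t \<ge> 0"
  shows "((\<lambda>t. lyap (X t) (V t)) has_real_derivative lyap_deriv (X t) (V t)) (at t within {0..})"
  unfolding lyap_def lyap_deriv_def
  by (intro DERIV_add DERIV_cmult energy_derivative[OF assms]
      has_real_derivative_norm_sq solution_derivatives(2)[OF assms])

text \<open>Completing the square: the cross term
  \<open>2 * c * m * q * inner v (gradient f x)\<close> merges with the gradient term into
  \<open>norm (gradient f x - q *\<^sub>R v)\<close> squared. This costs half of the new damping
  \<open>2 * c * m * q\<^sup>2\<close> of \<open>v\<close>; the other half remains.\<close>

lemma lyap_deriv_le:
  "lyap_deriv x v \<le> - (c * q / 2 * (f x - f xs) + q * c * (n / 2 + m * q) * (norm v)\<^sup>2)"
proof -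
  have "0 \<le> c * m * (norm (gradient f x - q *\<^sub>R v))\<^sup>2"
    using c_nonneg m by simp
  moreover have "c * q / 2 * (f x - f xs) \<le> c * q / 2 * inner (gradient f x) (x - xs)"
    using c_nonneg q gap_le_inner by (intro mult_left_mono) auto
  moreover have "lyap_deriv x v = - (c * m * (norm (gradient f x - q *\<^sub>R v))\<^sup>2)
    - c * q / 2 * inner (gradient f x) (x - xs) - q * c * (n / 2 + m * q) * (norm v)\<^sup>2"
  proof -
    have "- k * m * (norm g)\<^sup>2 - i - n * k * q / 2 * (norm v)\<^sup>2 + k * m * q * (2 * inner v (g - q *\<^sub>R v))
      = - (k * m * (norm (g - q *\<^sub>R v))\<^sup>2) - i - q * k * (n / 2 + m * q) * (norm v)\<^sup>2" for k i and g :: 'a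
      by (simp add: power2_norm_eq_inner inner_diff_left inner_diff_right inner_commute field_simps)
    then show ?thesis
      unfolding lyap_deriv_def .
  qed
  ultimately show ?thesis by linarith
qed

lemma lyap_nonincreasing:
  assumes "momentum_solution X V" "0 \<le> s" "s \<le> t"
  shows "lyap (X t) (V t) \<le> lyap (X s) (V s)"
proof (rule nonincreasing_of_derivative[OF lyap_derivative[OF assms(1)] _ assms(2,3)])
  fix t :: real
  have "0 \<le> c * q / 2 * (f (X t) - f xs)" "0 \<le> q * c * (n / 2 + m * q) * (norm (V t))\<^sup>2"
    using c_nonneg m n q minimal[of "X t"] by simp_all
  then show "lyap_deriv (X t) (V t) \<le> 0"
    using lyap_deriv_le[of "X t" "V t"] by linarith
qed

lemma lyap_ge: "c * (f x - f xs) + c * (n / 4 + m * q) * (norm v)\<^sup>2 \<le> lyap x v"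
proof -
  have "lyap x v = c * (f x - f xs) + c * (n / 4 + m * q) * (norm v)\<^sup>2
      + 1 / 4 * (norm (q *\<^sub>R (x - xs) - n *\<^sub>R v))\<^sup>2"
    unfolding lyap_def energy_def by (simp add: field_simps del: norm_scaleR)
  then show ?thesis by simp
qed

lemma lyap_continuous:
  assumes "\<eta> > 0"
  obtains \<delta> where "\<delta> > 0" "\<And>x v. dist (x, v) (xs, 0) < \<delta> \<Longrightarrow> lyap x v < \<eta>"
proof -
  have "isCont f (fst (xs, 0::'a))"
    using differentiable_imp_continuous_within[OF differentiable[of xs]] by simp
  then have "isCont (\<lambda>z. f (fst z)) (xs, 0::'a)"
    by (rule isCont_o2[rotated]) (intro continuous_intros)
  then have "isCont (\<lambda>z. lyap (fst z) (snd z)) (xs, 0)"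
    unfolding lyap_def energy_def by (intro continuous_intros)
  then obtain \<delta> where "\<delta> > 0" and \<delta>: "\<And>z. dist z (xs, 0) < \<delta> \<Longrightarrow>
      dist (lyap (fst z) (snd z)) (lyap xs 0) < \<eta>"
    unfolding continuous_at_eps_delta using assms by fastforce
  moreover have "lyap xs 0 = 0"
    by (simp add: lyap_def energy_def)
  ultimately show thesis
    using that[of \<delta>] \<delta>[of "(_, _)"] by (force simp: dist_real_def)
qed

end

section \<open>Asymptotic stability\<close>

text \<open>At least two parameters must be positive. With n alone the energy is conserved, with q
  alone X is constant, and with m alone X + m V is constant; in none of these cases is the
  equilibrium globally attractive.\<close>

locale stable_momentum = convex_momentum +
  assumes unique: "y \<noteq> xs \<Longrightarrow> f xs < f y"
    and two_positive: "(n > 0 \<and> m > 0) \<or> (n > 0 \<and> q > 0) \<or> (m > 0 \<and> q > 0)"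
begin

section \<open>Coercivity of the gap and of the Lyapunov function\<close>

lemma c_pos: "c > 0"
  using two_positive m n q by (auto simp: add_pos_nonneg add_nonneg_pos)

lemma v_weight_pos: "n / 4 + m * q > 0"
  using two_positive m n q by (auto simp: add_pos_nonneg add_nonneg_pos)

text \<open>Compactness gives a positive minimal gap on the sphere of radius \<epsilon>. The segment
  from \<open>xs\<close> to a farther point \<open>x\<close> crosses that sphere at
  \<open>y\<close>, and convexity along it makes the gap grow at least linearly.\<close>

lemma gap_growth:
  assumes "\<epsilon> > 0"
  obtains \<eta> where "\<eta> > 0" "\<And>x. \<epsilon> \<le> norm (x - xs) \<Longrightarrow> \<eta> * norm (x - xs) \<le> f x - f xs"
proof -
  have "continuous_on (sphere xs \<epsilon>) f"
    using differentiable differentiable_imp_continuous_within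
    by (metis continuous_at_imp_continuous_on)
  moreover have "sphere xs \<epsilon> \<noteq> {}"
    using assms by simp
  ultimately obtain y0 where y0: "y0 \<in> sphere xs \<epsilon>" "\<And>y. y \<in> sphere xs \<epsilon> \<Longrightarrow> f y0 \<le> f y"
    using continuous_attains_inf[OF compact_sphere] by metis
  define \<eta> where "\<eta> = (f y0 - f xs) / \<epsilon>"
  have "y0 \<noteq> xs"
    using y0(1) assms by auto
  then have "\<eta> > 0"
    using unique assms by (simp add: \<eta>_def)
  moreover have "\<eta> * norm (x - xs) \<le> f x - f xs" if "\<epsilon> \<le> norm (x - xs)" for x
  proof -
    define s where "s = \<epsilon> / norm (x - xs)"
    have pos: "norm (x - xs) > 0"
      using that assms by linarith
    have s: "0 \<le> s" "s \<le> 1"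
      using that assms by (simp_all add: s_def divide_le_eq_1)
    define y where "y = xs + s *\<^sub>R (x - xs)"
    have "y \<in> sphere xs \<epsilon>"
      using pos assms by (simp add: y_def dist_norm s_def)
    then have "f y0 \<le> f y"
      by (rule y0(2))
    \<comment> \<open>Since \<open>y\<close> is the convex combination of \<open>x\<close> and
      \<open>xs\<close> with weights \<open>s\<close> and \<open>1 - s\<close>, the gradient terms
      cancel; Jensen's inequality thus follows from the tangent inequality at
      \<open>y\<close>.\<close>
    also have "\<dots> = s * (f y + inner (gradient f y) (x - y))
        + (1 - s) * (f y + inner (gradient f y) (xs - y))"
      by (simp add: y_def inner_diff_right inner_add_right algebra_simps)
    also have "\<dots> \<le> s * f x + (1 - s) * f xs"
      using s gradient_le by (intro add_mono mult_left_mono) auto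
    finally have "f y0 - f xs \<le> s * (f x - f xs)"
      by (simp add: algebra_simps)
    then show ?thesis
      using pos assms by (simp add: s_def \<eta>_def field_simps)
  qed
  ultimately show thesis by (rule that)
qed

text \<open>The weights are left free because the lemma is applied both to the lower bound of
  \<open>lyap\<close> and to the dissipation rate for q > 0.\<close>

lemma weighted_small:
  assumes "\<epsilon> > 0" "a > 0" "b > 0"
  obtains \<eta> where "\<eta> > 0"
    "\<And>x (v :: 'a). a * (f x - f xs) + b * (norm v)\<^sup>2 < \<eta> \<Longrightarrow> dist (x, v) (xs, 0) < \<epsilon>"
proof -
  obtain \<theta> where \<theta>: "\<theta> > 0" "\<And>x. \<epsilon> / 2 \<le> norm (x - xs) \<Longrightarrow> \<theta> * norm (x - xs) \<le> f x - f xs"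
    using gap_growth[of "\<epsilon> / 2"] assms(1) by auto
  \<comment> \<open>Below this threshold either summand alone forces its component to have norm less
    than \<open>\<epsilon> / 2\<close>.\<close>
  define \<eta> where "\<eta> = min (a * (\<theta> * (\<epsilon> / 2))) (b * (\<epsilon> / 2)\<^sup>2)"
  have "\<eta> > 0"
    using \<theta>(1) assms by (simp add: \<eta>_def)
  moreover have "dist (x, v) (xs, 0) < \<epsilon>" if less: "a * (f x - f xs) + b * (norm v)\<^sup>2 < \<eta>" for x and v :: 'a
  proof -
    have nonneg: "0 \<le> a * (f x - f xs)" "0 \<le> b * (norm v)\<^sup>2"
      using assms minimal[of x] by simp_all
    have x: "norm (x - xs) < \<epsilon> / 2"
    proof (rule ccontr)
      assume *: "\<not> norm (x - xs) < \<epsilon> / 2"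
      then have "\<theta> * (\<epsilon> / 2) \<le> \<theta> * norm (x - xs)"
        using \<theta>(1) by (intro mult_left_mono) auto
      also have "\<dots> \<le> f x - f xs"
        using * by (intro \<theta>(2)) simp
      finally have "a * (\<theta> * (\<epsilon> / 2)) \<le> a * (f x - f xs)"
        using assms(2) by (intro mult_left_mono) auto
      then show False
        using less nonneg by (simp add: \<eta>_def)
    qed
    have "b * (norm v)\<^sup>2 < b * (\<epsilon> / 2)\<^sup>2"
      using less nonneg by (simp add: \<eta>_def)
    then have "(norm v)\<^sup>2 < (\<epsilon> / 2)\<^sup>2"
      using assms(3) by simp
    then have v: "norm v < \<epsilon> / 2"
      by (rule power2_less_imp_less) (use assms(1) in simp)
    have "dist (x, v) (xs, 0) \<le> norm (x - xs) + norm v"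
      unfolding dist_norm diff_Pair diff_0_right by (rule norm_Pair_le)
    then show ?thesis
      using x v by linarith
  qed
  ultimately show thesis by (rule that)
qed

lemma lyap_small:
  assumes "\<epsilon> > 0"
  obtains \<eta> where "\<eta> > 0" "\<And>x v. lyap x v < \<eta> \<Longrightarrow> dist (x, v) (xs, 0) < \<epsilon>"
proof -
  from weighted_small[OF assms c_pos mult_pos_pos[OF c_pos v_weight_pos]]
  obtain \<eta> where "\<eta> > 0" and \<eta>: "\<And>x (v :: 'a). c * (f x - f xs) + c * (n / 4 + m * q) * (norm v)\<^sup>2 < \<eta> \<Longrightarrow>
      dist (x, v) (xs, 0) < \<epsilon>"
    by blast
  then show thesis
    using that[of \<eta>] order_le_less_trans[OF lyap_ge] by blast
qed

section \<open>Reaching small values of the Lyapunov function, for q > 0 and for q = 0\<close>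

text \<open>For q > 0 the dissipation is itself a positive combination of the gap and the squared
  velocity. When it is small the state is near equilibrium, and \<open>lyap\<close> is small by
  continuity.\<close>

lemma lyap_gets_small_damped:
  assumes sol: "momentum_solution X V" and "q > 0" "\<eta> > 0"
  obtains t where "t \<ge> 0" "lyap (X t) (V t) < \<eta>"
proof -
  obtain \<delta> where "\<delta> > 0" and \<delta>: "\<And>x v. dist (x, v) (xs, 0) < \<delta> \<Longrightarrow> lyap x v < \<eta>"
    using lyap_continuous[OF \<open>\<eta> > 0\<close>] by blast
  let ?w = "\<lambda>t. c * q / 2 * (f (X t) - f xs) + q * c * (n / 2 + m * q) * (norm (V t))\<^sup>2"
  have "c * q / 2 > 0" "q * c * (n / 2 + m * q) > 0"
    using c_pos v_weight_pos \<open>q > 0\<close> n by (auto intro!: mult_pos_pos)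
  from weighted_small[OF \<open>\<delta> > 0\<close> this]
  obtain \<kappa> where "\<kappa> > 0" and \<kappa>: "\<And>x (v :: 'a). c * q / 2 * (f x - f xs)
      + q * c * (n / 2 + m * q) * (norm v)\<^sup>2 < \<kappa> \<Longrightarrow> dist (x, v) (xs, 0) < \<delta>"
    by blast
  have nonneg: "0 \<le> lyap (X t) (V t)" for t
  proof -
    have "0 \<le> c * (f (X t) - f xs) + c * (n / 4 + m * q) * (norm (V t))\<^sup>2"
      using c_pos v_weight_pos minimal[of "X t"] by simp
    then show ?thesis
      by (rule order_trans[OF _ lyap_ge])
  qed
  obtain t where "t \<ge> 0" "?w t < \<kappa>"
    by (rule dissipation_gets_small[OF lyap_derivative[OF sol] lyap_deriv_le nonneg \<open>\<kappa> > 0\<close>])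
  then show thesis
    using that \<kappa> \<delta> by blast
qed

text \<open>For q = 0 the dissipation \<open>n * m * (norm (gradient f x))\<^sup>2\<close> does not
  see V. Perturbing by <D, V> alone would leave <D, g>, of first order in |g| and not absorbable by
  |g|^2; the weight |V|^2 turns it into a multiple of |g| |V|^2, which Young's inequality splits
  into |g|^2 and |V|^4.\<close>

lemma lyap_gets_small_undamped:
  assumes sol: "momentum_solution X V" and "q = 0" "\<eta> > 0"
  obtains t where "t \<ge> 0" "lyap (X t) (V t) < \<eta>"
proof -
  have mn: "m > 0" "n > 0"
    using two_positive \<open>q = 0\<close> by auto
  have lyap_eq: "lyap x v = n * (f x - f xs) + n\<^sup>2 / 2 * (norm v)\<^sup>2" for x v
    unfolding lyap_def energy_def using \<open>q = 0\<close> by (simp add: power_mult_distrib power2_eq_square)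
  define E0 where "E0 = lyap (X 0) (V 0)"
  have E0: "n * (f (X t) - f xs) + n\<^sup>2 / 2 * (norm (V t))\<^sup>2 \<le> E0" if "t \<ge> 0" for t
    using lyap_nonincreasing[OF sol order_refl that] by (simp add: E0_def lyap_eq)
  obtain \<theta> where \<theta>: "\<theta> > 0" "\<And>x. 1 \<le> norm (x - xs) \<Longrightarrow> \<theta> * norm (x - xs) \<le> f x - f xs"
    using gap_growth[of 1] by auto
  \<comment> \<open>Outside the unit ball the gap is at least \<theta> times the distance, while
    \<open>n\<close> times the gap never exceeds \<open>E0\<close>.\<close>
  define R where "R = max 1 (E0 / (n * \<theta>))"
  have "R \<ge> 1"
    by (simp add: R_def)
  have R: "norm (X t - xs) \<le> R" if "t \<ge> 0" for t
  proof (cases "norm (X t - xs) \<le> 1")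
    case False
    then have "n * (\<theta> * norm (X t - xs)) \<le> n * (f (X t) - f xs)"
      using \<theta>(2)[of "X t"] n by (intro mult_left_mono) auto
    also have "\<dots> \<le> E0"
    proof -
      have "0 \<le> n\<^sup>2 / 2 * (norm (V t))\<^sup>2" by simp
      with E0[OF that] show ?thesis by linarith
    qed
    finally have "norm (X t - xs) \<le> E0 / (n * \<theta>)"
      using mn \<theta>(1) by (simp add: field_simps)
    then show ?thesis by (simp add: R_def)
  qed (simp add: R_def)
  define B where "B = sqrt (2 * E0 / n\<^sup>2)"
  have B: "norm (V t) \<le> B" if "t \<ge> 0" for t
  proof -
    have "0 \<le> n * (f (X t) - f xs)"
      using mn minimal[of "X t"] by simp
    then have "n\<^sup>2 / 2 * (norm (V t))\<^sup>2 \<le> E0"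
      using E0[OF that] by simp
    then have "(norm (V t))\<^sup>2 \<le> 2 * E0 / n\<^sup>2"
      using mn by (simp add: field_simps)
    then show ?thesis
      by (simp add: B_def real_le_rsqrt)
  qed
  have "B \<ge> 0"
    using B[of 0] norm_ge_zero order_trans by blast
  \<comment> \<open>Collects the factors of \<open>G * v\<^sup>2\<close>: \<open>2 * R\<close> from
    differentiating the weight, \<open>R\<close> from <D, g>, and \<open>m * B\<close> from the term
    - m <g, V>.\<close>
  define K where "K = 3 * R + m * B"
  have "K > 0"
    using \<open>R \<ge> 1\<close> \<open>B \<ge> 0\<close> m by (simp add: K_def add_pos_nonneg)
  \<comment> \<open>Chosen so that the Young cost \<open>b * K\<^sup>2 * G\<^sup>2 / (2 * n)\<close>
    uses up exactly half of the dissipation \<open>n * m * G\<^sup>2\<close>.\<close>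
  define b where "b = n\<^sup>2 * m / K\<^sup>2"
  have "b > 0"
    using mn \<open>K > 0\<close> by (simp add: b_def)
  let ?g = "\<lambda>t. gradient f (X t)"
  let ?\<phi> = "\<lambda>t. lyap (X t) (V t) + b * ((norm (V t))\<^sup>2 * inner (X t - xs) (V t))"
  let ?w = "\<lambda>t. n * m / 2 * (norm (?g t))\<^sup>2 + b * n / 2 * ((norm (V t))\<^sup>2)\<^sup>2"
  let ?\<phi>' = "\<lambda>t. - n * m * (norm (?g t))\<^sup>2 + b * (2 * inner (V t) (?g t) * inner (X t - xs) (V t)
      + (norm (V t))\<^sup>2 * (inner (X t - xs) (?g t) - m * inner (?g t) (V t) - n * (norm (V t))\<^sup>2))"
  have der: "(?\<phi> has_real_derivative ?\<phi>' t) (at t within {0..})" if "t \<ge> 0" for t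
  proof -
    have dX: "((\<lambda>t. X t - xs) has_vector_derivative (- m *\<^sub>R ?g t - n *\<^sub>R V t)) (at t within {0..})"
      using solution_derivatives(1)[OF sol that] by (auto intro!: derivative_eq_intros)
    have dV: "(V has_vector_derivative ?g t) (at t within {0..})"
      using solution_derivatives(2)[OF sol that] \<open>q = 0\<close> by simp
    have "((\<lambda>t. lyap (X t) (V t)) has_real_derivative - n * m * (norm (?g t))\<^sup>2) (at t within {0..})"
      using lyap_derivative[OF sol that] unfolding lyap_deriv_def using \<open>q = 0\<close> by simp
    note DERIV_add[OF this DERIV_cmult[OF DERIV_mult[OF has_real_derivative_norm_sq[OF dV]
          has_real_derivative_inner[OF dX dV]], of b]]
    then show ?thesis
      by (rule DERIV_cong)
        (simp add: inner_diff_left power2_norm_eq_inner inner_commute algebra_simps)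
  qed
  have le: "?\<phi>' t \<le> - ?w t" if "t \<ge> 0" for t
  proof -
    define v where "v = norm (V t)"
    define G where "G = norm (?g t)"
    have vG: "0 \<le> v" "0 \<le> G" "v \<le> B"
      using B[OF that] by (simp_all add: v_def G_def)
    have "inner (V t) (?g t) * inner (X t - xs) (V t) \<le> \<bar>inner (V t) (?g t)\<bar> * \<bar>inner (X t - xs) (V t)\<bar>"
      by (simp add: abs_mult[symmetric])
    also have "\<dots> \<le> (v * G) * (R * v)"
      unfolding v_def G_def
      by (intro mult_mono Cauchy_Schwarz_ineq2 order_trans[OF Cauchy_Schwarz_ineq2] mult_right_mono R[OF that])
         auto
    finally have 1: "inner (V t) (?g t) * inner (X t - xs) (V t) \<le> R * G * v\<^sup>2"
      by (simp add: power2_eq_square mult_ac)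
    have 2: "inner (X t - xs) (?g t) \<le> R * G"
      using norm_cauchy_schwarz[of "X t - xs" "?g t"] mult_right_mono[OF R[OF that], of G]
      by (simp add: G_def)
    have "- inner (?g t) (V t) \<le> G * v"
      using norm_cauchy_schwarz[of "- ?g t" "V t"] by (simp add: G_def v_def)
    also have "\<dots> \<le> G * B"
      using vG by (intro mult_left_mono)
    finally have 3: "- m * inner (?g t) (V t) \<le> m * (G * B)"
      using mult_left_mono[OF _ m, of "- inner (?g t) (V t)"] by simp
    have "inner (X t - xs) (?g t) - m * inner (?g t) (V t) - n * v\<^sup>2 \<le> R * G + m * (G * B) - n * v\<^sup>2"
      using 2 3 by simp
    then have "v\<^sup>2 * (inner (X t - xs) (?g t) - m * inner (?g t) (V t) - n * v\<^sup>2)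
        \<le> v\<^sup>2 * (R * G + m * (G * B) - n * v\<^sup>2)"
      by (intro mult_left_mono) auto
    with 1 have "2 * inner (V t) (?g t) * inner (X t - xs) (V t)
      + v\<^sup>2 * (inner (X t - xs) (?g t) - m * inner (?g t) (V t) - n * v\<^sup>2)
      \<le> K * G * v\<^sup>2 - n * (v\<^sup>2)\<^sup>2"
      by (simp add: K_def power2_eq_square algebra_simps)
    \<comment> \<open>Young's inequality, spending half of the available
      \<open>n * (v\<^sup>2)\<^sup>2\<close>.\<close>
    also have "K * G * v\<^sup>2 \<le> K\<^sup>2 * G\<^sup>2 / (2 * n) + n / 2 * (v\<^sup>2)\<^sup>2"
      using zero_le_power2[of "K * G - n * v\<^sup>2"] mn
      by (simp add: power2_diff power_mult_distrib field_simps power2_eq_square)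
    finally have "b * (2 * inner (V t) (?g t) * inner (X t - xs) (V t)
      + v\<^sup>2 * (inner (X t - xs) (?g t) - m * inner (?g t) (V t) - n * v\<^sup>2))
      \<le> b * (K\<^sup>2 * G\<^sup>2 / (2 * n) - n / 2 * (v\<^sup>2)\<^sup>2)"
      using \<open>b > 0\<close> by (intro mult_left_mono) auto
    also have "\<dots> = n * m / 2 * G\<^sup>2 - b * n / 2 * (v\<^sup>2)\<^sup>2"
    proof -
      have "b * K\<^sup>2 = n\<^sup>2 * m"
        using \<open>K > 0\<close> by (simp add: b_def)
      then have "b * (K\<^sup>2 * G\<^sup>2 / (2 * n)) = n * m / 2 * G\<^sup>2"
        using mn by (simp add: mult.assoc[symmetric] power2_eq_square)
      then show ?thesis
        unfolding right_diff_distrib by (simp only: mult.assoc times_divide_eq_right times_divide_eq_left)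
    qed
    finally show ?thesis
      by (simp add: v_def G_def)
  qed
  \<comment> \<open>The perturbation has no sign, but it is bounded on the region where the solution
    stays.\<close>
  have below: "- (b * (B\<^sup>2 * (R * B))) \<le> ?\<phi> t" if "t \<ge> 0" for t
  proof -
    have "\<bar>(norm (V t))\<^sup>2 * inner (X t - xs) (V t)\<bar> \<le> B\<^sup>2 * (R * B)"
      unfolding abs_mult
      by (intro mult_mono order_trans[OF Cauchy_Schwarz_ineq2])
        (use B[OF that] R[OF that] \<open>R \<ge> 1\<close> \<open>B \<ge> 0\<close> in \<open>auto intro!: power_mono mult_nonneg_nonneg\<close>)
    then have "- (B\<^sup>2 * (R * B)) \<le> (norm (V t))\<^sup>2 * inner (X t - xs) (V t)"
      by linarith
    then have "b * - (B\<^sup>2 * (R * B)) \<le> b * ((norm (V t))\<^sup>2 * inner (X t - xs) (V t))"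
      using \<open>b > 0\<close> by (intro mult_left_mono) auto
    moreover have "0 \<le> lyap (X t) (V t)"
      using mn minimal[of "X t"] by (simp add: lyap_eq)
    ultimately show ?thesis by simp
  qed
  \<comment> \<open>The bounds \<open>\<alpha>\<close> on |g| and \<open>\<beta>\<close> on |V|^2
    each contribute at most \<open>\<eta> / 2\<close> to \<open>lyap\<close>; the gap is controlled
    by |g| |D|, hence by \<open>\<alpha> * R\<close>.\<close>
  define \<alpha> where "\<alpha> = \<eta> / (2 * n * R)"
  define \<beta> where "\<beta> = \<eta> / n\<^sup>2"
  have ab: "\<alpha> > 0" "\<beta> > 0"
    using mn \<open>\<eta> > 0\<close> \<open>R \<ge> 1\<close> by (simp_all add: \<alpha>_def \<beta>_def)
  define \<kappa> where "\<kappa> = min (n * m / 2 * \<alpha>\<^sup>2) (b * n / 2 * \<beta>\<^sup>2)"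
  have "\<kappa> > 0"
    using mn \<open>b > 0\<close> ab by (simp add: \<kappa>_def)
  then obtain t where "t \<ge> 0" and t: "?w t < \<kappa>"
    using dissipation_gets_small[OF der le below] by blast
  have nonneg: "0 \<le> n * m / 2 * (norm (?g t))\<^sup>2" "0 \<le> b * n / 2 * ((norm (V t))\<^sup>2)\<^sup>2"
    using mn \<open>b > 0\<close> by simp_all
  then have "n * m / 2 * (norm (?g t))\<^sup>2 < n * m / 2 * \<alpha>\<^sup>2"
    "b * n / 2 * ((norm (V t))\<^sup>2)\<^sup>2 < b * n / 2 * \<beta>\<^sup>2"
    using t by (auto simp: \<kappa>_def)
  then have "(norm (?g t))\<^sup>2 < \<alpha>\<^sup>2" "((norm (V t))\<^sup>2)\<^sup>2 < \<beta>\<^sup>2"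
    using mn \<open>b > 0\<close> by simp_all
  then have small: "norm (?g t) < \<alpha>" "(norm (V t))\<^sup>2 < \<beta>"
    using ab by (auto intro: power2_less_imp_less)
  have "f (X t) - f xs \<le> norm (?g t) * norm (X t - xs)"
    using gap_le_inner norm_cauchy_schwarz order_trans by blast
  also have "\<dots> \<le> \<alpha> * R"
    using small R[OF \<open>t \<ge> 0\<close>] ab by (intro mult_mono) auto
  finally have "n * (f (X t) - f xs) \<le> n * (\<alpha> * R)"
    using mn by (intro mult_left_mono) auto
  also have "\<dots> = \<eta> / 2"
    using mn \<open>R \<ge> 1\<close> by (simp add: \<alpha>_def)
  finally have "n * (f (X t) - f xs) \<le> \<eta> / 2" .
  moreover have "n\<^sup>2 / 2 * (norm (V t))\<^sup>2 < n\<^sup>2 / 2 * \<beta>"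
    using small mn by (intro mult_strict_left_mono) auto
  moreover have "n\<^sup>2 / 2 * \<beta> = \<eta> / 2"
    using mn by (simp add: \<beta>_def)
  ultimately have "lyap (X t) (V t) < \<eta>"
    by (simp add: lyap_eq)
  with \<open>t \<ge> 0\<close> show thesis by (rule that)
qed

lemma momentum_solution_of_pair:
  "ode_solution (momentum_field f m n q) z \<Longrightarrow> momentum_solution (\<lambda>t. fst (z t)) (\<lambda>t. snd (z t))"
  by (simp add: momentum_solution_def)

text \<open>Stability: a sublevel set of \<open>lyap\<close> lies inside the \<epsilon>-ball,
  contains a \<delta>-ball, and cannot be left. Attractivity: once \<open>lyap\<close> is below the
  level for \<epsilon> it remains so, hence one such time is enough.\<close>

theorem stable: "globally_asymptotically_stable (momentum_field f m n q) (xs, 0)"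
  unfolding globally_asymptotically_stable_def
proof (intro conjI)
  show "momentum_field f m n q (xs, 0) = 0"
    using minimizer_gradient_zero[OF differentiable minimal]
    by (simp add: momentum_field_def zero_prod_def)
  show "lyapunov_stable (momentum_field f m n q) (xs, 0)"
    unfolding lyapunov_stable_def
  proof (intro allI impI)
    fix \<epsilon> :: real assume "\<epsilon> > 0"
    then obtain \<eta> where "\<eta> > 0" and \<eta>: "\<And>x v. lyap x v < \<eta> \<Longrightarrow> dist (x, v) (xs, 0) < \<epsilon>"
      using lyap_small by blast
    obtain \<delta> where "\<delta> > 0" and \<delta>: "\<And>x v. dist (x, v) (xs, 0) < \<delta> \<Longrightarrow> lyap x v < \<eta>"
      using lyap_continuous[OF \<open>\<eta> > 0\<close>] by blast
    have "dist (z t) (xs, 0) < \<epsilon>"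
      if "ode_solution (momentum_field f m n q) z" "dist (z 0) (xs, 0) < \<delta>" "t \<ge> 0" for z t
      using lyap_nonincreasing[OF momentum_solution_of_pair[OF that(1)] order_refl that(3)]
        \<delta>[of "fst (z 0)" "snd (z 0)"] \<eta>[of "fst (z t)" "snd (z t)"] that(2) by simp
    with \<open>\<delta> > 0\<close> show "\<exists>\<delta>>0. \<forall>z. ode_solution (momentum_field f m n q) z \<longrightarrow>
        dist (z 0) (xs, 0) < \<delta> \<longrightarrow> (\<forall>t\<ge>0. dist (z t) (xs, 0) < \<epsilon>)"
      by blast
  qed
  show "globally_attractive (momentum_field f m n q) (xs, 0)"
    unfolding globally_attractive_def
  proof (intro allI impI tendstoI)
    fix z and \<epsilon> :: real
    assume "ode_solution (momentum_field f m n q) z" and "\<epsilon> > 0"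
    note sol = momentum_solution_of_pair[OF this(1)]
    obtain \<eta> where "\<eta> > 0" and \<eta>: "\<And>x v. lyap x v < \<eta> \<Longrightarrow> dist (x, v) (xs, 0) < \<epsilon>"
      using lyap_small[OF \<open>\<epsilon> > 0\<close>] by blast
    obtain t where "t \<ge> 0" "lyap (fst (z t)) (snd (z t)) < \<eta>"
      using lyap_gets_small_damped[OF sol _ \<open>\<eta> > 0\<close>] lyap_gets_small_undamped[OF sol _ \<open>\<eta> > 0\<close>] q
      by (metis order_le_less)
    then have "dist (z s) (xs, 0) < \<epsilon>" if "s \<ge> t" for s
      using lyap_nonincreasing[OF sol _ that] \<eta>[of "fst (z s)" "snd (z s)"] by simp
    then show "\<forall>\<^sub>F s in at_top. dist (z s) (xs, 0) < \<epsilon>"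
      by (auto simp: eventually_at_top_linorder)
  qed
qed

end

text \<open>For \<mu> = 0 there may be several minimizers, each giving a constant solution, so
  global attraction can only be claimed for a unique one. The decay estimate holds for every choice
  of minimizer.\<close>

theorem theorem1:
  fixes f :: "real ^ 'd \<Rightarrow> real" and xs :: "real ^ 'd" and \<mu> L m n q :: real
  assumes "strongly_convex \<mu> f" and "\<mu> \<ge> 0"
    and "smooth_fun L f"
    and "is_arg_min f (\<lambda>_. True) xs"
    and "n \<ge> 0" and "m \<ge> 0" and "q \<ge> 0"
  shows "(\<forall>X V. ode_solution (momentum_field f m n q) (\<lambda>t. (X t, V t)) \<longrightarrow>
            (\<forall>t\<ge>0. energy f xs m n q (X t) (V t)
                     \<le> exp (- rate1 \<mu> m n q * t) * energy f xs m n q (X 0) (V 0)))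
       \<and> ((\<forall>y. is_arg_min f (\<lambda>_. True) y \<longrightarrow> y = xs) \<longrightarrow>
          (n > 0 \<and> m > 0) \<or> (n > 0 \<and> q > 0) \<or> (m > 0 \<and> q > 0) \<longrightarrow>
            globally_asymptotically_stable (momentum_field f m n q) (xs, 0))"
proof -
  have min: "f xs \<le> f y" for y
    using assms(4) by (simp add: is_arg_min_linorder)
  interpret convex_momentum f xs m n q
  proof
    show "f differentiable (at x)" for x
      using assms(3) by (simp add: smooth_fun_def)
    show "f x + inner (gradient f x) (y - x) \<le> f y" for x y
    proof -
      have "f x + inner (gradient f x) (y - x) + \<mu> / 2 * (norm (y - x))\<^sup>2 \<le> f y"
        using assms(1) by (simp add: strongly_convex_def)
      moreover have "0 \<le> \<mu> / 2 * (norm (y - x))\<^sup>2"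
        using assms(2) by simp
      ultimately show ?thesis by linarith
    qed
  qed (use assms min in auto)
  show ?thesis
  proof (intro conjI allI impI)
    fix X V and t :: real
    assume "ode_solution (momentum_field f m n q) (\<lambda>t. (X t, V t))" and "t \<ge> 0"
    then show "energy f xs m n q (X t) (V t)
        \<le> exp (- rate1 \<mu> m n q * t) * energy f xs m n q (X 0) (V 0)"
      using energy_decay[OF assms(1,2)] by (simp add: momentum_solution_def)
  next
    assume uniq: "\<forall>y. is_arg_min f (\<lambda>_. True) y \<longrightarrow> y = xs"
      and two: "(n > 0 \<and> m > 0) \<or> (n > 0 \<and> q > 0) \<or> (m > 0 \<and> q > 0)"
    interpret stable_momentum f xs m n q
    proof
      show "f xs < f y" if "y \<noteq> xs" for y
      proof (rule ccontr)
        assume "\<not> f xs < f y"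
        then have "f y \<le> f z" for z
          using min[of z] by linarith
        then have "is_arg_min f (\<lambda>_. True) y"
          by (simp add: is_arg_min_linorder)
        with uniq that show False by blast
      qed
    qed (rule two)
    show "globally_asymptotically_stable (momentum_field f m n q) (xs, 0)"
      by (rule stable)
  qed
qed

end
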